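(* Let $G$ be a group with identity $e$ and $|G|=n\ge 2$. Let $S,T\subseteq G\setminus\{e\}$ be disjoint and let $V=(G\setminus\{e\})\setminus(S\cup T)$, so that $G\setminus\{e\}=S\cup T\cup V$. Let $\omega=-\frac12+i\frac{\sqrt3}{2}$. For $x\in G$ put $$\begin{aligned}F(x)={}&N_{(S,S)}^x+\omega^2N_{(T,T)}^x+\omega N_{(V,V)}^x+\omega\big(N_{(S,T)}^x+N_{(T,S)}^x\big)\\&+\omega^2\big(N_{(S,V)}^x+N_{(V,S)}^x\big)+N_{(T,V)}^x+N_{(V,T)}^x.\end{aligned}$$ Then there exists a $k$ such that $(S,T)$ is a signature pair of sets for an $(n,k)$-cube root equiangular frame if and only if the following hold: (1) $S=S^{-1}$ and $T^{-1}=V$; (2) there exists an integer $\mu$ such that (a) $F(g)=\mu$ for all $g\in S$; (b) $F(h)=\omega\mu$ for all $h\in T$; (c) $F(\tilde h)=\omega^2\mu$ for all $\tilde h\in V$. In this case $k$ and $\mu$ are related by $$\mu=(n-2k)\sqrt{\frac{n-1}{k(n-k)}},\qquad k=\frac n2-\frac{\mu n}{2\sqrt{4(n-1)+\mu^2}}.$$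
   Context: For subsets $A,B\subseteq G$ and $g\in G$, $N_{(A,B)}^g=\#\{(g_1,g_2)\in A\times B: g_1g_2=g\}$, and $A^{-1}=\{a^{-1}:a\in A\}$. An $(n,k)$-frame is a Parseval frame $\{f_1,\dots,f_n\}$ for $\mathbb C^k$, i.e. $\sum_{j}|\langle x,f_j\rangle|^2=\|x\|^2$ for all $x\in\mathbb C^k$. It is equiangular if all $f_i\neq 0$ and there is a constant $b$ with $|\langle f_i/\|f_i\|,f_j/\|f_j\|\rangle|=b$ for all $i\ne j$. For $1\le k<n$, put $c_{n,k}=\sqrt{\frac{k(n-k)}{n^2(n-1)}}$. A self-adjoint $n\times n$ matrix $Q$ with $Q_{ii}=0$ and $|Q_{ij}|=1$ for $i\neq j$ is the signature matrix of an $(n,k)$-equiangular frame if there is an equiangular $(n,k)$-frame whose Gram matrix $(\langle f_j,f_i\rangle)_{i,j}$ equals $\frac kn I_n+c_{n,k}Q$. Throughout $1\le k<n$. Let $\lambda$ be the left regular representation of $G$: $\lambda(g)e_h=e_{gh}$ on the vector space with basis $\{e_h\}_{h\in G}$, regarded as $n\times n$ permutation matrices. $(S,T)$ is a signature pair of sets for an $(n,k)$-cube root equiangular frame if $Q=\sum_{g\in S}\lambda(g)+\omega\sum_{g\in T}\lambda(g)+\omega^2\sum_{g\in V}\lambda(g)$ is the signature matrix of an $(n,k)$-equiangular frame. *)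

theory Defs
  imports "HOL-Algebra.Coset" "Jordan_Normal_Form.Schur_Decomposition"
begin

section \<open>Equiangular Parseval frames\<close>

text \<open>The inner product of \<open>\<complex>\<^sup>k\<close> is \<open>x \<bullet>c y\<close>, linear in the first argument and
  conjugate-linear in the second. A frame of \<open>n\<close> vectors is the family \<open>f 0, \<dots>, f (n - 1)\<close>.\<close>

definition l2_norm :: "complex vec \<Rightarrow> real" where
  "l2_norm x = sqrt (Re (x \<bullet>c x))"

definition parseval_frame :: "nat \<Rightarrow> nat \<Rightarrow> (nat \<Rightarrow> complex vec) \<Rightarrow> bool" where
  "parseval_frame n k f \<longleftrightarrow>
     (\<forall>j<n. f j \<in> carrier_vec k) \<and>
     (\<forall>x\<in>carrier_vec k. (\<Sum>j<n. (cmod (x \<bullet>c f j))\<^sup>2) = (l2_norm x)\<^sup>2)"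

definition normalized :: "complex vec \<Rightarrow> complex vec" where
  "normalized x = complex_of_real (1 / l2_norm x) \<cdot>\<^sub>v x"

definition equiangular_frame :: "nat \<Rightarrow> nat \<Rightarrow> (nat \<Rightarrow> complex vec) \<Rightarrow> bool" where
  "equiangular_frame n k f \<longleftrightarrow>
     parseval_frame n k f \<and>
     (\<forall>i<n. f i \<noteq> 0\<^sub>v k) \<and>
     (\<exists>b::real. \<forall>i<n. \<forall>j<n. i \<noteq> j \<longrightarrow>
        cmod (normalized (f i) \<bullet>c normalized (f j)) = b)"

definition gram_matrix :: "nat \<Rightarrow> (nat \<Rightarrow> complex vec) \<Rightarrow> complex mat" where
  "gram_matrix n f = mat n n (\<lambda>(i, j). f j \<bullet>c f i)"

definition frame_const :: "nat \<Rightarrow> nat \<Rightarrow> real" where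
  "frame_const n k = sqrt (real k * (real n - real k) / ((real n)\<^sup>2 * (real n - 1)))"

definition signature_matrix :: "nat \<Rightarrow> nat \<Rightarrow> complex mat \<Rightarrow> bool" where
  "signature_matrix n k Q \<longleftrightarrow>
     1 \<le> k \<and> k < n \<and>
     Q \<in> carrier_mat n n \<and> mat_adjoint Q = Q \<and>
     (\<forall>i<n. Q $$ (i, i) = 0) \<and>
     (\<forall>i<n. \<forall>j<n. i \<noteq> j \<longrightarrow> cmod (Q $$ (i, j)) = 1) \<and>
     (\<exists>f. equiangular_frame n k f \<and>
        gram_matrix n f =
          complex_of_real (real k / real n) \<cdot>\<^sub>m 1\<^sub>m n + complex_of_real (frame_const n k) \<cdot>\<^sub>m Q)"

section \<open>Signature pairs of sets\<close>

definition \<omega>\<^sub>3 :: complex where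
  "\<omega>\<^sub>3 = - 1 / 2 + \<i> * complex_of_real (sqrt 3 / 2)"

text \<open>Regarding \<open>\<lambda>(g)\<close> as an \<open>n \<times> n\<close> matrix requires ordering the basis
  \<open>(e\<^sub>h)\<close>; the bijection \<open>enum\<close> from \<open>{..<|G|}\<close> to \<open>carrier G\<close> records this ordering.
  Column \<open>j\<close> is the image of the basis vector labelled by \<open>enum j\<close>.\<close>

definition left_regular :: "('a, 'b) monoid_scheme \<Rightarrow> (nat \<Rightarrow> 'a) \<Rightarrow> 'a \<Rightarrow> complex mat" where
  "left_regular G enum g =
     mat (Coset.order G) (Coset.order G) (\<lambda>(i, j). if enum i = g \<otimes>\<^bsub>G\<^esub> enum j then 1 else 0)"

definition left_regular_sum :: "('a, 'b) monoid_scheme \<Rightarrow> (nat \<Rightarrow> 'a) \<Rightarrow> 'a set \<Rightarrow> complex mat" where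
  "left_regular_sum G enum A =
     finsum (module_mat TYPE(complex) (Coset.order G) (Coset.order G)) (left_regular G enum) A"

definition cube_root_signature_pair ::
  "('a, 'b) monoid_scheme \<Rightarrow> (nat \<Rightarrow> 'a) \<Rightarrow> nat \<Rightarrow> 'a set \<Rightarrow> 'a set \<Rightarrow> bool" where
  "cube_root_signature_pair G enum k S T \<longleftrightarrow>
     (let V = (carrier G - {\<one>\<^bsub>G\<^esub>}) - (S \<union> T) in
      signature_matrix (Coset.order G) k
        (left_regular_sum G enum S + \<omega>\<^sub>3 \<cdot>\<^sub>m left_regular_sum G enum T
           + \<omega>\<^sub>3\<^sup>2 \<cdot>\<^sub>m left_regular_sum G enum V))"

definition N_mult :: "('a, 'b) monoid_scheme \<Rightarrow> 'a set \<Rightarrow> 'a set \<Rightarrow> 'a \<Rightarrow> nat" where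
  "N_mult G A B g = card {(g1, g2) \<in> A \<times> B. g1 \<otimes>\<^bsub>G\<^esub> g2 = g}"

definition F_sum ::
  "('a, 'b) monoid_scheme \<Rightarrow> 'a set \<Rightarrow> 'a set \<Rightarrow> 'a set \<Rightarrow> 'a \<Rightarrow> complex" where
  "F_sum G S T V x =
     of_nat (N_mult G S S x) + \<omega>\<^sub>3\<^sup>2 * of_nat (N_mult G T T x) + \<omega>\<^sub>3 * of_nat (N_mult G V V x)
     + \<omega>\<^sub>3 * (of_nat (N_mult G S T x) + of_nat (N_mult G T S x))
     + \<omega>\<^sub>3\<^sup>2 * (of_nat (N_mult G S V x) + of_nat (N_mult G V S x))
     + of_nat (N_mult G T V x) + of_nat (N_mult G V T x)"

definition F_condition ::
  "('a, 'b) monoid_scheme \<Rightarrow> 'a set \<Rightarrow> 'a set \<Rightarrow> 'a set \<Rightarrow> int \<Rightarrow> bool" where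
  "F_condition G S T V \<mu> \<longleftrightarrow>
     (\<forall>g\<in>S. F_sum G S T V g = of_int \<mu>) \<and>
     (\<forall>h\<in>T. F_sum G S T V h = \<omega>\<^sub>3 * of_int \<mu>) \<and>
     (\<forall>h\<in>V. F_sum G S T V h = \<omega>\<^sub>3\<^sup>2 * of_int \<mu>)"

end

theory Submission
  imports Defs
begin

text \<open>Let \<open>q\<close> be the function on \<open>G\<close> with value \<open>1\<close>, \<open>\<omega>\<close>, \<open>\<omega>\<^sup>2\<close> on \<open>S\<close>, \<open>T\<close>, \<open>V\<close> and \<open>0\<close> at the
  identity. The matrix in question is the operator \<open>Q = \<Sum>\<^sub>g q g \<lambda>(g)\<close>, and \<open>F\<close> is the
  convolution square of \<open>q\<close>, so that \<open>Q\<^sup>2 = \<Sum>\<^sub>g F g \<lambda>(g)\<close>. Condition (1) says that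
  \<open>q (inv x)\<close> is the conjugate of \<open>q x\<close>, which is self-adjointness of \<open>Q\<close>. Given this, condition (2)
  says that \<open>F = (n - 1) \<delta> + \<mu> q\<close> with \<open>\<delta>\<close> the indicator of the identity, that is,
  \<open>Q\<^sup>2 = (n - 1) I + \<mu> Q\<close>.

  On the side of frames, Gram matrices of \<open>n\<close>-element Parseval frames for \<open>\<complex>\<^sup>k\<close> are exactly the
  Hermitian idempotents of trace \<open>k\<close>
  (\<open>parseval_frame_gram_idempotent\<close>, \<open>hermitian_idempotent_is_gram\<close>). Expanding idempotency of
  \<open>(k/n) I + c Q\<close> turns it into \<open>Q\<^sup>2 = (n - 1) I + \<mu> Q\<close> with
  \<open>\<mu> = (n - 2k) sqrt ((n - 1) / (k (n - k)))\<close> (\<open>signature_matrix_iff_quadratic\<close>). This gives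
  the forward implication, up to the integrality of \<open>\<mu>\<close>, which holds because \<open>F\<close> takes values in
  the Eisenstein integers (\<open>real_multiplier_integral\<close>).

  For the converse, a self-adjoint matrix with \<open>Q\<^sup>2 = (n - 1) I + \<mu> Q\<close> has its eigenvalues among
  two numbers of opposite signs.
  The projection onto the positive eigenspace is of the form \<open>t I + c Q\<close>; its trace \<open>n t\<close> is the
  rank, and this is the required \<open>k\<close> (\<open>quadratic_hermitian_rank\<close>).\<close>

section \<open>Arithmetic of the cube root of unity\<close>

lemma
  shows omega3_sq: "\<omega>\<^sub>3\<^sup>2 = - 1 - \<omega>\<^sub>3"
    and cnj_omega3: "cnj \<omega>\<^sub>3 = \<omega>\<^sub>3\<^sup>2"
    and cnj_omega3_sq: "cnj (\<omega>\<^sub>3\<^sup>2) = \<omega>\<^sub>3"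
    and omega3_cube: "\<omega>\<^sub>3 * \<omega>\<^sub>3\<^sup>2 = 1"
    and omega3_fourth: "\<omega>\<^sub>3\<^sup>2 * \<omega>\<^sub>3\<^sup>2 = \<omega>\<^sub>3"
    and cmod_omega3: "cmod \<omega>\<^sub>3 = 1"
    and Im_omega3: "Im \<omega>\<^sub>3 = sqrt 3 / 2"
    and omega3_distinct: "\<omega>\<^sub>3 \<noteq> 1" "\<omega>\<^sub>3\<^sup>2 \<noteq> 1" "\<omega>\<^sub>3\<^sup>2 \<noteq> \<omega>\<^sub>3"
proof -
  show Im: "Im \<omega>\<^sub>3 = sqrt 3 / 2" by (simp add: \<omega>\<^sub>3_def)
  show sq: "\<omega>\<^sub>3\<^sup>2 = - 1 - \<omega>\<^sub>3"
    by (simp add: \<omega>\<^sub>3_def complex_eq_iff power2_eq_square)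
  show "cnj \<omega>\<^sub>3 = \<omega>\<^sub>3\<^sup>2" by (simp add: sq, simp add: \<omega>\<^sub>3_def complex_eq_iff)
  then show "cnj (\<omega>\<^sub>3\<^sup>2) = \<omega>\<^sub>3" by (metis complex_cnj_cnj)
  have "\<omega>\<^sub>3 * \<omega>\<^sub>3\<^sup>2 = \<omega>\<^sub>3 * (- 1 - \<omega>\<^sub>3)" by (simp only: sq)
  also have "\<dots> = - \<omega>\<^sub>3 - \<omega>\<^sub>3\<^sup>2" by (simp add: algebra_simps power2_eq_square)
  also have "\<dots> = 1" by (simp add: sq)
  finally show cube: "\<omega>\<^sub>3 * \<omega>\<^sub>3\<^sup>2 = 1" .
  have "\<omega>\<^sub>3\<^sup>2 * \<omega>\<^sub>3\<^sup>2 = \<omega>\<^sub>3 * (\<omega>\<^sub>3 * \<omega>\<^sub>3\<^sup>2)" by (simp only: power2_eq_square mult.assoc)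
  then show "\<omega>\<^sub>3\<^sup>2 * \<omega>\<^sub>3\<^sup>2 = \<omega>\<^sub>3" by (simp only: cube mult_1_right)
  show "cmod \<omega>\<^sub>3 = 1" by (simp add: \<omega>\<^sub>3_def cmod_def power_divide)
  show "\<omega>\<^sub>3 \<noteq> 1" using Im by auto
  show "\<omega>\<^sub>3\<^sup>2 \<noteq> 1" "\<omega>\<^sub>3\<^sup>2 \<noteq> \<omega>\<^sub>3" unfolding sq using Im by (auto simp: complex_eq_iff)
qed

section \<open>Hermitian idempotents and Gram matrices of Parseval frames\<close>

text \<open>The diagonal entry is the squared norm of a column, because \<open>p = p\<^sup>* p\<close>. In particular
  the trace of a Hermitian idempotent is nonnegative, and a vanishing diagonal entry forces its
  column to vanish.\<close>

lemma hermitian_idempotent_diag: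
  fixes p :: "'i \<Rightarrow> 'i \<Rightarrow> complex"
  assumes herm: "\<And>i j. i \<in> I \<Longrightarrow> j \<in> I \<Longrightarrow> p j i = cnj (p i j)"
    and idem: "\<And>i j. i \<in> I \<Longrightarrow> j \<in> I \<Longrightarrow> (\<Sum>l\<in>I. p i l * p l j) = p i j"
    and i: "i \<in> I"
  shows "p i i = of_real (\<Sum>l\<in>I. (cmod (p l i))\<^sup>2)"
proof -
  have "p i i = (\<Sum>l\<in>I. p i l * p l i)" using idem i by simp
  also have "\<dots> = (\<Sum>l\<in>I. of_real ((cmod (p l i))\<^sup>2))"
  proof (rule sum.cong[OF refl])
    fix l assume "l \<in> I"
    then show "p i l * p l i = of_real ((cmod (p l i))\<^sup>2)"
      unfolding herm[OF \<open>l \<in> I\<close> i] complex_norm_square by (simp add: mult.commute)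
  qed
  finally show ?thesis by simp
qed

text \<open>A projection is \<open>\<Sum>\<^sub>a v\<^sub>a v\<^sub>a\<^sup>*\<close> for an orthonormal basis \<open>v\<close> of its range. Instead of
  invoking the spectral theorem, the proof peels off one direction at a time: a nonzero column,
  normalised, is a unit vector \<open>v\<close> in the range, and \<open>p - v v\<^sup>*\<close> is again a Hermitian
  idempotent, which annihilates \<open>v\<close>. Each step lowers the trace by 1, and the trace stays
  nonnegative, so the process stops.\<close>

lemma hermitian_idempotent_decomposition:
  fixes p :: "'i \<Rightarrow> 'i \<Rightarrow> complex"
  assumes fin: "finite I"
    and herm: "\<And>i j. i \<in> I \<Longrightarrow> j \<in> I \<Longrightarrow> p j i = cnj (p i j)"
    and idem: "\<And>i j. i \<in> I \<Longrightarrow> j \<in> I \<Longrightarrow> (\<Sum>l\<in>I. p i l * p l j) = p i j"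
  shows "\<exists>(k :: nat) v. (\<forall>a<k. \<forall>b<k. (\<Sum>i\<in>I. v a i * cnj (v b i)) = of_bool (a = b)) \<and>
           (\<forall>i\<in>I. \<forall>j\<in>I. p i j = (\<Sum>a<k. v a i * cnj (v a j)))"
  using herm idem
proof (induction "nat \<lfloor>Re (\<Sum>i\<in>I. p i i)\<rfloor>" arbitrary: p rule: less_induct)
  case less
  note herm = less.prems(1) and idem = less.prems(2)
  note diag = hermitian_idempotent_diag[OF herm idem]
  show ?case
  proof (cases "\<forall>i\<in>I. \<forall>j\<in>I. p i j = 0")
    case True
    then show ?thesis by (auto intro!: exI[of _ "0 :: nat"])
  next
    case False
    then obtain i0 j0 where ij0: "i0 \<in> I" "j0 \<in> I" "p i0 j0 \<noteq> 0" by blast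
    define r where "r = (\<Sum>l\<in>I. (cmod (p l j0))\<^sup>2)"
    have r: "p j0 j0 = of_real r" using diag ij0 by (simp add: r_def)
    have "r \<noteq> 0" unfolding r_def using ij0 fin by (subst sum_nonneg_eq_0_iff) auto
    moreover have "r \<ge> 0" unfolding r_def by (auto intro: sum_nonneg)
    ultimately have rpos: "r > 0" by simp
    \<comment> \<open>As \<open>r\<close> is both the squared norm of column \<open>j0\<close> and the diagonal entry there, division
      by its square root normalises the column.\<close>
    define s where "s = complex_of_real (sqrt r)"
    have s: "s \<noteq> 0" "s * s = of_real r" "cnj s = s"
      using rpos by (auto simp: s_def simp flip: of_real_mult)
    define v where "v i = p i j0 / s" for i
    define q where "q i j = p i j - v i * cnj (v j)" for i j
    have vv: "(\<Sum>i\<in>I. v i * cnj (v i)) = 1"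
    proof -
      have "(\<Sum>i\<in>I. v i * cnj (v i)) = (\<Sum>i\<in>I. p j0 i * p i j0 / (s * s))"
        by (rule sum.cong) (use herm[OF _ ij0(2)] s in \<open>auto simp: v_def mult.commute\<close>)
      also have "\<dots> = p j0 j0 / (s * s)" using idem ij0 by (simp flip: sum_divide_distrib)
      finally show ?thesis using r s rpos by simp
    qed
    have pv: "(\<Sum>l\<in>I. p i l * v l) = v i" if "i \<in> I" for i
      using idem[OF that ij0(2)] by (simp add: v_def flip: sum_divide_distrib)
    have vp: "(\<Sum>l\<in>I. cnj (v l) * p l i) = cnj (v i)" if "i \<in> I" for i
    proof -
      have "(\<Sum>l\<in>I. cnj (v l) * p l i) = cnj (\<Sum>l\<in>I. p i l * v l)"
        unfolding cnj_sum by (rule sum.cong) (use herm[OF that] in \<open>auto simp: mult.commute\<close>)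
      then show ?thesis using pv that by simp
    qed
    have qv: "(\<Sum>l\<in>I. q i l * v l) = 0" if "i \<in> I" for i
    proof -
      have "(\<Sum>l\<in>I. q i l * v l) = (\<Sum>l\<in>I. p i l * v l) - v i * (\<Sum>l\<in>I. v l * cnj (v l))"
        by (simp add: q_def algebra_simps sum_subtractf sum_distrib_left)
      then show ?thesis using pv vv that by simp
    qed
    have qherm: "q j i = cnj (q i j)" if "i \<in> I" "j \<in> I" for i j
      using herm[OF that] by (simp add: q_def mult.commute)
    have qidem: "(\<Sum>l\<in>I. q i l * q l j) = q i j" if "i \<in> I" "j \<in> I" for i j
    proof -
      have "(\<Sum>l\<in>I. q i l * q l j) = (\<Sum>l\<in>I. q i l * p l j) - (\<Sum>l\<in>I. q i l * v l) * cnj (v j)"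
        by (simp add: q_def[of _ j] algebra_simps sum_subtractf sum_distrib_left)
      also have "\<dots> = (\<Sum>l\<in>I. p i l * p l j) - v i * (\<Sum>l\<in>I. cnj (v l) * p l j)"
        using qv[OF that(1)] by (simp add: q_def algebra_simps sum_subtractf sum_distrib_left)
      finally show ?thesis using idem vp that by (simp add: q_def)
    qed
    have tr: "(\<Sum>i\<in>I. p i i) = (\<Sum>i\<in>I. q i i) + 1"
      using vv by (simp add: q_def sum_subtractf)
    have "Re (\<Sum>i\<in>I. q i i) \<ge> 0"
    proof -
      have "q i i = of_real (\<Sum>l\<in>I. (cmod (q l i))\<^sup>2)" if "i \<in> I" for i
        using qherm qidem that by (rule hermitian_idempotent_diag)
      then show ?thesis by (auto intro!: sum_nonneg)
    qed
    then have "nat \<lfloor>Re (\<Sum>i\<in>I. q i i)\<rfloor> < nat \<lfloor>Re (\<Sum>i\<in>I. p i i)\<rfloor>"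
      unfolding tr by simp
    then have "\<exists>(k :: nat) w. (\<forall>a<k. \<forall>b<k. (\<Sum>i\<in>I. w a i * cnj (w b i)) = of_bool (a = b)) \<and>
           (\<forall>i\<in>I. \<forall>j\<in>I. q i j = (\<Sum>a<k. w a i * cnj (w a j)))"
      using qherm qidem by (rule less.hyps)
    then obtain k :: nat and w where
      ortho: "\<And>a b. a < k \<Longrightarrow> b < k \<Longrightarrow> (\<Sum>i\<in>I. w a i * cnj (w b i)) = of_bool (a = b)"
      and qw: "\<And>i j. i \<in> I \<Longrightarrow> j \<in> I \<Longrightarrow> q i j = (\<Sum>a<k. w a i * cnj (w a j))"
      by blast
    \<comment> \<open>Expanding \<open>q v = 0\<close> in the vectors \<open>w\<close> and pairing with \<open>w b\<close> isolates the
      coefficient of \<open>w b\<close>, which is the inner product of \<open>v\<close> with \<open>w b\<close>.\<close>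
    have vw: "(\<Sum>i\<in>I. v i * cnj (w b i)) = 0" if b: "b < k" for b
    proof -
      have "0 = (\<Sum>i\<in>I. cnj (w b i) * (\<Sum>l\<in>I. q i l * v l))" using qv by simp
      also have "\<dots> = (\<Sum>i\<in>I. \<Sum>l\<in>I. \<Sum>a<k. (w a i * cnj (w b i)) * (v l * cnj (w a l)))"
        by (intro sum.cong refl)
          (simp add: qw sum_distrib_left sum_distrib_right mult_ac cong: sum.cong)
      also have "\<dots> = (\<Sum>a<k. (\<Sum>i\<in>I. w a i * cnj (w b i)) * (\<Sum>l\<in>I. v l * cnj (w a l)))"
        unfolding sum_product
        by (rule trans[OF sum.cong[OF refl sum.swap] sum.swap])
      also have "\<dots> = (\<Sum>a<k. if a = b then (\<Sum>l\<in>I. v l * cnj (w a l)) else 0)"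
        by (intro sum.cong refl) (simp add: ortho b)
      finally show ?thesis using b by simp
    qed
    have wv: "(\<Sum>i\<in>I. w b i * cnj (v i)) = 0" if b: "b < k" for b
      using arg_cong[OF vw[OF b], of cnj] by (simp add: mult.commute)
    show ?thesis
    proof (intro exI[of _ "Suc k"] exI[of _ "\<lambda>a. if a = k then v else w a"] conjI allI impI ballI)
      fix a b assume "a < Suc k" "b < Suc k"
      then show "(\<Sum>i\<in>I. (if a = k then v else w a) i * cnj ((if b = k then v else w b) i))
          = of_bool (a = b)"
        using vv vw wv ortho by (auto simp: less_Suc_eq)
    next
      fix i j assume "i \<in> I" "j \<in> I"
      then show "p i j = (\<Sum>a<Suc k. (if a = k then v else w a) i * cnj ((if a = k then v else w a) j))"
        using qw[of i j] by (simp add: q_def algebra_simps)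
    qed
  qed
qed

lemma cscalar_prod_sum:
  assumes "x \<in> carrier_vec k" "y \<in> carrier_vec k"
  shows "x \<bullet>c y = (\<Sum>a<k. x $ a * cnj (y $ a))"
  using assms by (simp add: scalar_prod_def atLeast0LessThan)

lemma l2_norm_sq:
  assumes "x \<in> carrier_vec k"
  shows "(l2_norm x)\<^sup>2 = (\<Sum>a<k. (cmod (x $ a))\<^sup>2)"
  using assms
  by (simp add: l2_norm_def cscalar_prod_sum[of x k] sum_nonneg cmod_power2 flip: power2_eq_square)

text \<open>Polarisation: the quadratic form \<open>x \<mapsto> \<Sum>\<^sub>j |\<langle>x, f\<^sub>j\<rangle>|\<^sup>2 - |x|\<^sup>2\<close> vanishes identically if and
  only if its coefficient matrix does. So the Parseval identity says that the \<open>k\<close> rows of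
  the matrix with columns \<open>f\<^sub>j\<close> are orthonormal.\<close>

lemma parseval_frame_iff_orthonormal_coordinates:
  "parseval_frame n k f \<longleftrightarrow> (\<forall>j<n. f j \<in> carrier_vec k) \<and>
     (\<forall>a<k. \<forall>b<k. (\<Sum>j<n. f j $ a * cnj (f j $ b)) = of_bool (a = b))"
proof (cases "\<forall>j<n. f j \<in> carrier_vec k")
  case True
  then have f: "f j \<in> carrier_vec k" if "j < n" for j using that by blast
  define m where "m a b = (\<Sum>j<n. f j $ a * cnj (f j $ b))" for a b
  have energy: "complex_of_real (\<Sum>j<n. (cmod (x \<bullet>c f j))\<^sup>2) =
      (\<Sum>a<k. \<Sum>b<k. x $ a * cnj (x $ b) * m b a)" if x: "x \<in> carrier_vec k" for x
  proof -
    have "complex_of_real (\<Sum>j<n. (cmod (x \<bullet>c f j))\<^sup>2) =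
        (\<Sum>j<n. (\<Sum>a<k. x $ a * cnj (f j $ a)) * cnj (\<Sum>b<k. x $ b * cnj (f j $ b)))"
      unfolding of_real_sum
      by (intro sum.cong refl)
        (use f x in \<open>simp add: complex_norm_square cscalar_prod_sum[of x k] del: cnj_sum of_real_power\<close>)
    also have "\<dots> = (\<Sum>j<n. \<Sum>a<k. \<Sum>b<k. x $ a * cnj (x $ b) * (f j $ b * cnj (f j $ a)))"
      by (simp add: sum_product mult_ac)
    also have "\<dots> = (\<Sum>a<k. \<Sum>b<k. x $ a * cnj (x $ b) * m b a)"
      unfolding m_def sum_distrib_left
      by (rule trans[OF sum.swap sum.cong[OF refl sum.swap]])
    finally show ?thesis .
  qed
  have "(\<forall>x\<in>carrier_vec k. (\<Sum>j<n. (cmod (x \<bullet>c f j))\<^sup>2) = (l2_norm x)\<^sup>2) \<longleftrightarrow>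
      (\<forall>a<k. \<forall>b<k. m a b = of_bool (a = b))" (is "?P \<longleftrightarrow> ?M")
  proof
    assume ?M
    show ?P
    proof
      fix x :: "complex vec" assume x: "x \<in> carrier_vec k"
      have "complex_of_real (\<Sum>j<n. (cmod (x \<bullet>c f j))\<^sup>2) =
          (\<Sum>a<k. \<Sum>b<k. if b = a then x $ a * cnj (x $ b) else 0)"
        unfolding energy[OF x] by (intro sum.cong refl) (use \<open>?M\<close> in auto)
      also have "\<dots> = complex_of_real ((l2_norm x)\<^sup>2)"
        unfolding l2_norm_sq[OF x] of_real_sum by (intro sum.cong refl) (simp add: complex_norm_square del: of_real_power)
      finally show "(\<Sum>j<n. (cmod (x \<bullet>c f j))\<^sup>2) = (l2_norm x)\<^sup>2"
        unfolding of_real_eq_iff .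
    qed
  next
    assume ?P
    have P: "(\<Sum>a<k. x a * (\<Sum>b<k. cnj (x b) * m b a)) = (\<Sum>a<k. x a * cnj (x a))" for x
    proof -
      have "(\<Sum>a<k. \<Sum>b<k. x a * cnj (x b) * m b a) = (\<Sum>a<k. x a * cnj (x a))"
        using \<open>?P\<close> energy[of "vec k x"]
        by (simp add: l2_norm_sq[of _ k] complex_norm_square del: of_real_power)
      then show ?thesis by (simp add: sum_distrib_left mult.assoc)
    qed
    have diag: "m a a = 1" if a: "a < k" for a
    proof -
      define x :: "nat \<Rightarrow> complex" where "x c = (if c = a then 1 else 0)" for c
      have A: "(\<Sum>c<k. x c * h c) = h a" "(\<Sum>c<k. cnj (x c) * h c) = h a" for h
        using a by (simp_all add: x_def if_distrib[of cnj] if_distrib[of "\<lambda>t. t * _"] cong: if_cong)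
      show ?thesis using P[of x] unfolding A by (simp add: x_def)
    qed
    have off: "m a b = 0" if ab: "a < k" "b < k" "a \<noteq> b" for a b
    proof -
      have "z * m a b + cnj z * m b a = 0" for z
      proof -
        define x where "x c = (if c = a then 1 else 0) + (if c = b then z else 0)" for c
        have A: "(\<Sum>c<k. x c * h c) = h a + z * h b" for h :: "nat \<Rightarrow> complex"
          using ab by (simp add: x_def distrib_right sum.distrib if_distrib[of "\<lambda>t. t * _"] cong: if_cong)
        have B: "(\<Sum>c<k. cnj (x c) * h c) = h a + cnj z * h b" for h :: "nat \<Rightarrow> complex"
          using ab by (simp add: x_def distrib_right sum.distrib if_distrib[of cnj] if_distrib[of "\<lambda>t. t * _"] cong: if_cong)
        show ?thesis
          using P[of x] unfolding A B using ab diag by (simp add: x_def algebra_simps)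
      qed
      \<comment> \<open>At \<open>z = 1\<close> the sum of the two entries vanishes, at \<open>z = \<i>\<close> their difference.\<close>
      from this[of 1] this[of \<i>] show ?thesis by (simp add: complex_eq_iff)
    qed
    show ?M using diag off by auto
  qed
  then show ?thesis unfolding parseval_frame_def m_def using True by blast
qed (auto simp: parseval_frame_def)

text \<open>Let \<open>M\<close> be the matrix with columns \<open>f\<^sub>j\<close>. The Gram matrix is \<open>M\<^sup>* M\<close>, and \<open>M M\<^sup>* = I\<close> by the
  previous lemma.\<close>

lemma parseval_frame_gram_idempotent:
  assumes f: "parseval_frame n k f" and ij: "i < n" "j < n"
  shows "(\<Sum>l<n. (f l \<bullet>c f i) * (f j \<bullet>c f l)) = f j \<bullet>c f i"
proof -
  have carr: "f l \<in> carrier_vec k" if "l < n" for l using f that by (simp add: parseval_frame_def)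
  have ortho: "(\<Sum>l<n. f l $ a * cnj (f l $ b)) = of_bool (a = b)" if "a < k" "b < k" for a b
    using f that by (simp add: parseval_frame_iff_orthonormal_coordinates)
  have "(\<Sum>l<n. (f l \<bullet>c f i) * (f j \<bullet>c f l)) =
      (\<Sum>l<n. \<Sum>a<k. \<Sum>b<k. (f j $ b * cnj (f i $ a)) * (f l $ a * cnj (f l $ b)))"
    using carr ij by (intro sum.cong refl) (simp add: cscalar_prod_sum[of _ k] sum_product mult_ac)
  also have "\<dots> = (\<Sum>a<k. \<Sum>b<k. (f j $ b * cnj (f i $ a)) * (\<Sum>l<n. f l $ a * cnj (f l $ b)))"
    unfolding sum_distrib_left by (rule trans[OF sum.swap sum.cong[OF refl sum.swap]])
  also have "\<dots> = (\<Sum>a<k. \<Sum>b<k. if b = a then f j $ b * cnj (f i $ a) else 0)"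
    by (intro sum.cong refl) (auto simp: ortho)
  also have "\<dots> = f j \<bullet>c f i" using carr ij by (simp add: cscalar_prod_sum[of _ k])
  finally show ?thesis .
qed

text \<open>The frame consists of the columns of the matrix with rows \<open>v\<^sub>a\<^sup>*\<close>, where \<open>v\<close> is an
  orthonormal basis of the range. The dimension \<open>k\<close> is not prescribed: it is the rank, which the
  trace computes. Hence this also shows that the trace is a natural number.\<close>

lemma hermitian_idempotent_is_gram:
  fixes p :: "nat \<Rightarrow> nat \<Rightarrow> complex"
  assumes herm: "\<And>i j. i < n \<Longrightarrow> j < n \<Longrightarrow> p j i = cnj (p i j)"
    and idem: "\<And>i j. i < n \<Longrightarrow> j < n \<Longrightarrow> (\<Sum>l<n. p i l * p l j) = p i j"
  shows "\<exists>k f. (\<Sum>i<n. p i i) = of_nat k \<and> parseval_frame n k f \<and>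
    (\<forall>i<n. \<forall>j<n. f j \<bullet>c f i = p i j)"
proof -
  have "\<exists>(k :: nat) v. (\<forall>a<k. \<forall>b<k. (\<Sum>i<n. v a i * cnj (v b i)) = of_bool (a = b)) \<and>
      (\<forall>i\<in>{..<n}. \<forall>j\<in>{..<n}. p i j = (\<Sum>a<k. v a i * cnj (v a j)))"
    by (rule hermitian_idempotent_decomposition) (simp_all add: idem, rule herm)
  then obtain k :: nat and v where
    ortho: "\<And>a b. a < k \<Longrightarrow> b < k \<Longrightarrow> (\<Sum>i<n. v a i * cnj (v b i)) = of_bool (a = b)"
    and pv: "\<forall>i\<in>{..<n}. \<forall>j\<in>{..<n}. p i j = (\<Sum>a<k. v a i * cnj (v a j))"
    by blast
  have p: "p i j = (\<Sum>a<k. v a i * cnj (v a j))" if "i < n" "j < n" for i j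
    using pv that by blast
  define f where "f j = vec k (\<lambda>a. cnj (v a j))" for j
  have carr: "f j \<in> carrier_vec k" for j by (simp add: f_def)
  have "(\<Sum>i<n. p i i) = (\<Sum>i<n. \<Sum>a<k. v a i * cnj (v a i))" by (simp add: p)
  also have "\<dots> = (\<Sum>a<k. \<Sum>i<n. v a i * cnj (v a i))" by (rule sum.swap)
  also have "\<dots> = of_nat k" by (simp add: ortho)
  finally have "(\<Sum>i<n. p i i) = of_nat k" .
  moreover have "parseval_frame n k f"
    unfolding parseval_frame_iff_orthonormal_coordinates
  proof (intro conjI allI impI)
    fix a b assume "a < k" "b < k"
    then show "(\<Sum>j<n. f j $ a * cnj (f j $ b)) = of_bool (a = b)"
      using ortho[of b a] by (simp add: f_def mult.commute eq_commute[of a b])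
  qed (rule carr)
  moreover have "f j \<bullet>c f i = p i j" if "i < n" "j < n" for i j
    unfolding p[OF that] cscalar_prod_sum[OF carr carr]
    by (intro sum.cong refl) (simp add: f_def mult.commute)
  ultimately show ?thesis by blast
qed

lemma equiangular_frameI:
  assumes f: "parseval_frame n k f"
    and diag: "\<And>i. i < n \<Longrightarrow> f i \<bullet>c f i = of_real t" and t: "t > 0"
    and off: "\<And>i j. i < n \<Longrightarrow> j < n \<Longrightarrow> i \<noteq> j \<Longrightarrow> cmod (f i \<bullet>c f j) = c"
  shows "equiangular_frame n k f"
proof -
  have carr: "f l \<in> carrier_vec k" if "l < n" for l using f that by (simp add: parseval_frame_def)
  have "f i \<noteq> 0\<^sub>v k" if "i < n" for i using diag[OF that] t by auto
  moreover have "cmod (normalized (f i) \<bullet>c normalized (f j)) = c / t"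
    if ij: "i < n" "j < n" "i \<noteq> j" for i j
  proof -
    have entry: "normalized (f l) $ a = of_real (1 / sqrt t) * f l $ a" if "l < n" "a < k" for l a
      using carr[OF that(1)] diag[OF that(1)] that by (simp add: normalized_def l2_norm_def)
    have "normalized (f l) \<in> carrier_vec k" if "l < n" for l
      using carr[OF that] by (simp add: normalized_def)
    then have "normalized (f i) \<bullet>c normalized (f j) =
        (\<Sum>a<k. normalized (f i) $ a * cnj (normalized (f j) $ a))"
      using ij by (simp add: cscalar_prod_sum[of _ k])
    also have "\<dots> =
        (\<Sum>a<k. (of_real (1 / sqrt t) * f i $ a) * cnj (of_real (1 / sqrt t) * f j $ a))"
      using ij by (intro sum.cong refl) (simp add: entry)
    also have "\<dots> = (of_real (1 / sqrt t) * of_real (1 / sqrt t)) * (f i \<bullet>c f j)"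
      using carr ij by (simp add: cscalar_prod_sum[of _ k] sum_distrib_left mult_ac)
    finally show ?thesis
      using off[OF ij] t by (simp add: norm_mult norm_divide)
  qed
  ultimately show ?thesis using f unfolding equiangular_frame_def by blast
qed

section \<open>Signature matrices and their quadratic equation\<close>

text \<open>The coefficient \<open>\<mu>\<close> in the quadratic equation \<open>Q\<^sup>2 = (n - 1) I + \<mu> Q\<close> of a signature
  matrix \<open>Q\<close> of an \<open>(n, k)\<close>-equiangular frame.\<close>

definition frame_multiplier :: "nat \<Rightarrow> nat \<Rightarrow> real" where
  "frame_multiplier n k = (real n - 2 * real k) * sqrt ((real n - 1) / (real k * (real n - real k)))"

text \<open>These are the coefficient identities that turn \<open>(t I + c Q)\<^sup>2 = t I + c Q\<close> into
  \<open>Q\<^sup>2 = (n - 1) I + \<mu> Q\<close>.\<close>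

lemma frame_const_relations:
  assumes "1 \<le> k" "k < n"
  defines "t \<equiv> real k / real n" and "c \<equiv> frame_const n k"
  shows "c > 0" "t * (1 - t) = c\<^sup>2 * (real n - 1)" "1 - 2 * t = c * frame_multiplier n k"
proof -
  have pos: "real k > 0" "real n - real k > 0" "real n - 1 > 0" "real n > 0" using assms(1,2) by auto
  show "c > 0" unfolding c_def frame_const_def using pos by simp
  have "c\<^sup>2 = real k * (real n - real k) / ((real n)\<^sup>2 * (real n - 1))"
    unfolding c_def frame_const_def using pos by simp
  then show "t * (1 - t) = c\<^sup>2 * (real n - 1)"
    using pos by (simp add: t_def field_simps power2_eq_square)
  have "c * sqrt ((real n - 1) / (real k * (real n - real k))) = sqrt ((1 / real n)\<^sup>2)"
    unfolding c_def frame_const_def real_sqrt_mult[symmetric]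
  proof (rule arg_cong[of _ _ sqrt])
    have cancel: "a / (m\<^sup>2 * b) * (b / a) = (1 / m)\<^sup>2" if "a \<noteq> 0" "b \<noteq> 0" for a b m :: real
      using that by (simp add: power_divide)
    show "real k * (real n - real k) / ((real n)\<^sup>2 * (real n - 1)) *
        ((real n - 1) / (real k * (real n - real k))) = (1 / real n)\<^sup>2"
      using pos by (intro cancel) auto
  qed
  then have "c * sqrt ((real n - 1) / (real k * (real n - real k))) = 1 / real n" by simp
  then have "c * frame_multiplier n k = (real n - 2 * real k) * (1 / real n)"
    unfolding frame_multiplier_def mult.left_commute[of c] by simp
  then show "1 - 2 * t = c * frame_multiplier n k" using pos by (simp add: t_def field_simps)
qed

lemma affine_idempotent_iff_quadratic:
  fixes q :: "'i \<Rightarrow> 'i \<Rightarrow> complex" and t c m \<mu> :: real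
  assumes fin: "finite I" and c: "c \<noteq> 0"
    and tm: "t * (1 - t) = c\<^sup>2 * m" and t\<mu>: "1 - 2 * t = c * \<mu>"
    and ij: "i \<in> I" "j \<in> I"
  defines "p \<equiv> \<lambda>i j. of_real t * of_bool (i = j) + of_real c * q i j"
  shows "(\<Sum>l\<in>I. p i l * p l j) = p i j \<longleftrightarrow>
    (\<Sum>l\<in>I. q i l * q l j) = of_real m * of_bool (i = j) + of_real \<mu> * q i j"
proof -
  define C where "C = complex_of_real c"
  define T where "T = complex_of_real t"
  let ?s = "\<Sum>l\<in>I. q i l * q l j"
  have "C \<noteq> 0" using c by (simp add: C_def)
  have TM: "T - T * T = C * C * of_real m" "1 - 2 * T = C * of_real \<mu>"
    using arg_cong[OF tm, of complex_of_real] arg_cong[OF t\<mu>, of complex_of_real]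
    by (simp_all add: C_def T_def power2_eq_square algebra_simps)
  have p: "p a b = T * of_bool (a = b) + C * q a b" for a b
    by (simp add: p_def C_def T_def)
  have "p i l * p l j = (if l = i then T * p i j else 0) + (if l = j then C * T * q i j else 0)
      + C * C * (q i l * q l j)" for l
    unfolding p by (simp add: distrib_left distrib_right)
  then have "(\<Sum>l\<in>I. p i l * p l j) = T * p i j + C * T * q i j + C * C * ?s"
    using fin ij by (simp add: sum.distrib sum_distrib_left)
  then have "(\<Sum>l\<in>I. p i l * p l j) - p i j =
      C * C * ?s - (T - T * T) * of_bool (i = j) - C * (1 - 2 * T) * q i j"
    unfolding p[of i j] by (simp add: algebra_simps del: sum_mult_of_bool_eq)
  also have "\<dots> = C * C * (?s - (of_real m * of_bool (i = j) + of_real \<mu> * q i j))"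
    unfolding TM by (simp add: algebra_simps)
  finally have "(\<Sum>l\<in>I. p i l * p l j) - p i j = 0 \<longleftrightarrow>
      ?s - (of_real m * of_bool (i = j) + of_real \<mu> * q i j) = 0"
    using \<open>C \<noteq> 0\<close> by (simp only: mult_eq_0_iff) blast
  then show ?thesis by (simp only: right_minus_eq)
qed

lemma mat_adjoint_eq_iff:
  fixes Q :: "complex mat"
  assumes Q: "Q \<in> carrier_mat n n"
  shows "mat_adjoint Q = Q \<longleftrightarrow> (\<forall>i<n. \<forall>j<n. Q $$ (j, i) = cnj (Q $$ (i, j)))"
proof -
  have "mat_adjoint Q = Q \<longleftrightarrow> (\<forall>i<n. \<forall>j<n. mat_adjoint Q $$ (j, i) = Q $$ (j, i))"
    using Q by (auto simp: mat_eq_iff mat_adjoint_def)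
  also have "\<dots> \<longleftrightarrow> (\<forall>i<n. \<forall>j<n. cnj (Q $$ (i, j)) = Q $$ (j, i))"
    using Q by (simp add: mat_adjoint_def mat_of_rows_def)
  finally show ?thesis by (simp only: eq_commute[of "cnj _"])
qed

text \<open>Gram matrices of \<open>(n, k)\<close>-Parseval frames are the Hermitian idempotents of trace \<open>k\<close>. Since
  \<open>Q\<close> has zero diagonal, \<open>(k/n) I + c Q\<close> has trace \<open>k\<close> for free, and its off-diagonal entries have
  constant modulus \<open>c\<close>; idempotency is thus the only condition left, and it is quadratic in \<open>Q\<close>.\<close>

lemma signature_matrix_iff_quadratic:
  assumes Q: "Q \<in> carrier_mat n n"
    and diag: "\<And>i. i < n \<Longrightarrow> Q $$ (i, i) = 0"
    and unim: "\<And>i j. i < n \<Longrightarrow> j < n \<Longrightarrow> i \<noteq> j \<Longrightarrow> cmod (Q $$ (i, j)) = 1"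
  shows "signature_matrix n k Q \<longleftrightarrow> 1 \<le> k \<and> k < n \<and>
    (\<forall>i<n. \<forall>j<n. Q $$ (j, i) = cnj (Q $$ (i, j))) \<and>
    (\<forall>i<n. \<forall>j<n. (\<Sum>l<n. Q $$ (i, l) * Q $$ (l, j)) =
        of_real (real n - 1) * of_bool (i = j) + of_real (frame_multiplier n k) * Q $$ (i, j))"
    (is "_ \<longleftrightarrow> _ \<and> _ \<and> ?herm \<and> ?quad")
proof (cases "1 \<le> k \<and> k < n \<and> ?herm")
  case False
  moreover have "1 \<le> k \<and> k < n \<and> ?herm" if "signature_matrix n k Q"
    using that unfolding signature_matrix_def mat_adjoint_eq_iff[OF Q] by (elim conjE, intro conjI)
  ultimately show ?thesis by argo
next
  case True
  then have kn: "1 \<le> k" "k < n" and herm: "?herm" by blast+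
  have adj: "mat_adjoint Q = Q" unfolding mat_adjoint_eq_iff[OF Q] by (rule herm)
  define t where "t = real k / real n"
  define c where "c = frame_const n k"
  have t0: "t > 0" using kn by (simp add: t_def)
  note rel = frame_const_relations[OF kn, folded t_def c_def]
  define p where "p i j = of_real t * of_bool (i = j) + of_real c * Q $$ (i, j)" for i j
  have gram: "gram_matrix n f = complex_of_real t \<cdot>\<^sub>m 1\<^sub>m n + complex_of_real c \<cdot>\<^sub>m Q \<longleftrightarrow>
      (\<forall>i<n. \<forall>j<n. f j \<bullet>c f i = p i j)" for f
    using Q by (auto simp: mat_eq_iff gram_matrix_def p_def)
  have idem: "(\<Sum>l<n. p i l * p l j) = p i j \<longleftrightarrow> (\<Sum>l<n. Q $$ (i, l) * Q $$ (l, j)) =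
        of_real (real n - 1) * of_bool (i = j) + of_real (frame_multiplier n k) * Q $$ (i, j)"
    if "i < n" "j < n" for i j
    unfolding p_def
    by (rule affine_idempotent_iff_quadratic[OF _ _ rel(2,3)]) (use rel(1) that in auto)
  have "(\<exists>f. equiangular_frame n k f \<and> (\<forall>i<n. \<forall>j<n. f j \<bullet>c f i = p i j)) \<longleftrightarrow>
      (\<forall>i<n. \<forall>j<n. (\<Sum>l<n. p i l * p l j) = p i j)" (is "?L \<longleftrightarrow> ?R")
  proof
    assume ?L
    then obtain f where "equiangular_frame n k f"
      and f_gram: "\<forall>i<n. \<forall>j<n. f j \<bullet>c f i = p i j" by (elim exE conjE)
    then have f: "parseval_frame n k f" by (simp add: equiangular_frame_def)
    show ?R
    proof (intro allI impI)
      fix i j assume ij: "i < n" "j < n"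
      show "(\<Sum>l<n. p i l * p l j) = p i j"
        using parseval_frame_gram_idempotent[OF f ij] f_gram ij by simp
    qed
  next
    assume R: ?R
    have pherm: "p j i = cnj (p i j)" if "i < n" "j < n" for i j
    proof -
      have "Q $$ (j, i) = cnj (Q $$ (i, j))" using herm that by blast
      then show ?thesis by (auto simp: p_def)
    qed
    have ridem: "(\<Sum>l<n. p i l * p l j) = p i j" if "i < n" "j < n" for i j using R that by simp
    have "\<exists>k' f. (\<Sum>i<n. p i i) = of_nat k' \<and> parseval_frame n k' f \<and>
        (\<forall>i<n. \<forall>j<n. f j \<bullet>c f i = p i j)"
      using pherm ridem by (rule hermitian_idempotent_is_gram)
    then obtain k' f where f: "(\<Sum>i<n. p i i) = of_nat k'" "parseval_frame n k' f"
      "\<forall>i<n. \<forall>j<n. f j \<bullet>c f i = p i j" by (elim exE conjE)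
    have "(\<Sum>i<n. p i i) = of_nat k"
      using kn diag by (simp add: p_def t_def)
    then have "k' = k" using f(1) by simp
    have "equiangular_frame n k f"
    proof (rule equiangular_frameI[of n k f t c])
      show "parseval_frame n k f" using f(2) \<open>k' = k\<close> by simp
      show "f i \<bullet>c f i = of_real t" if "i < n" for i using f(3) diag that by (simp add: p_def)
      show "cmod (f i \<bullet>c f j) = c" if "i < n" "j < n" "i \<noteq> j" for i j
        using f(3) unim[of j i] that rel(1) by (simp add: p_def norm_mult)
    qed (rule t0)
    then show ?L using f(3) by (intro exI[of _ f]) simp
  qed
  also have "\<dots> \<longleftrightarrow> ?quad" by (simp add: idem)
  finally have frame: "(\<exists>f. equiangular_frame n k f \<and> (\<forall>i<n. \<forall>j<n. f j \<bullet>c f i = p i j)) \<longleftrightarrow> ?quad" .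
  have "\<forall>i<n. Q $$ (i, i) = 0" "\<forall>i<n. \<forall>j<n. i \<noteq> j \<longrightarrow> cmod (Q $$ (i, j)) = 1"
    using diag unim by simp_all
  then show ?thesis
    unfolding signature_matrix_def t_def[symmetric] c_def[symmetric] gram frame
    using kn Q adj herm by argo
qed

text \<open>Conversely, the quadratic equation determines \<open>k\<close>. The roots of \<open>x\<^sup>2 = \<mu> x + (n - 1)\<close> have
  difference \<open>D\<close> and opposite signs, and subtracting the negative root from \<open>Q\<close> and dividing by
  \<open>D\<close> gives the spectral projection \<open>p = t I + c Q\<close> of the positive eigenvalue. Its trace \<open>n t\<close> is
  a natural number \<open>k\<close>, and \<open>0 < t < 1\<close> gives \<open>0 < k < n\<close>.\<close>

lemma quadratic_hermitian_rank:
  fixes q :: "nat \<Rightarrow> nat \<Rightarrow> complex"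
  assumes n: "n \<ge> 2"
    and herm: "\<And>i j. i < n \<Longrightarrow> j < n \<Longrightarrow> q j i = cnj (q i j)"
    and diag: "\<And>i. i < n \<Longrightarrow> q i i = 0"
    and quad: "\<And>i j. i < n \<Longrightarrow> j < n \<Longrightarrow>
      (\<Sum>l<n. q i l * q l j) = of_real (real n - 1) * of_bool (i = j) + of_real \<mu> * q i j"
  obtains k where "1 \<le> k" "k < n" "\<mu> = frame_multiplier n k"
proof -
  define D where "D = sqrt (\<mu>\<^sup>2 + 4 * (real n - 1))"
  have "\<mu>\<^sup>2 < \<mu>\<^sup>2 + 4 * (real n - 1)" using n by simp
  then have "sqrt (\<mu>\<^sup>2) < D" unfolding D_def by (rule real_sqrt_less_mono)
  then have D: "\<bar>\<mu>\<bar> < D" "D > 0" by auto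
  have D2: "D\<^sup>2 = \<mu>\<^sup>2 + 4 * (real n - 1)" unfolding D_def using n by simp
  define t where "t = (D - \<mu>) / (2 * D)"
  define c where "c = 1 / D"
  have c: "c > 0" using D by (simp add: c_def)
  have t: "0 < t" "t < 1" using D by (auto simp: t_def field_simps)
  have t_mu: "1 - 2 * t = c * \<mu>" using D by (simp add: t_def c_def field_simps)
  have "4 * (t * (1 - t)) = 1 - (1 - 2 * t)\<^sup>2" by (simp add: algebra_simps power2_eq_square)
  also have "\<dots> = c\<^sup>2 * (D\<^sup>2 - \<mu>\<^sup>2)" unfolding t_mu using D by (simp add: c_def field_simps)
  also have "\<dots> = 4 * (c\<^sup>2 * (real n - 1))"
    unfolding D2 by (simp only: add_diff_cancel_left' mult.left_commute)
  finally have tm: "t * (1 - t) = c\<^sup>2 * (real n - 1)" by (simp only: mult_cancel_left) simp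
  define p where "p i j = of_real t * of_bool (i = j) + of_real c * q i j" for i j
  have pidem: "(\<Sum>l<n. p i l * p l j) = p i j" if "i < n" "j < n" for i j
    using iffD2[OF affine_idempotent_iff_quadratic[OF _ _ tm t_mu] quad[OF that]] c that
    unfolding p_def by simp
  have pherm: "p j i = cnj (p i j)" if "i < n" "j < n" for i j
    unfolding p_def herm[OF that] by auto
  have "\<exists>k f. (\<Sum>i<n. p i i) = of_nat k \<and> parseval_frame n k f \<and>
      (\<forall>i<n. \<forall>j<n. f j \<bullet>c f i = p i j)"
    using pherm pidem by (rule hermitian_idempotent_is_gram)
  then obtain k where k: "(\<Sum>i<n. p i i) = of_nat k" by (elim exE conjE)
  have "of_nat k = complex_of_real (real n * t)" using k diag by (simp add: p_def)
  then have kt: "real k = real n * t" by (metis of_real_of_nat_eq of_real_eq_iff)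
  have "1 \<le> k" using kt t n by (cases k) auto
  moreover have kn: "k < n" using kt t n by (metis mult.right_neutral mult_less_cancel_left_pos of_nat_less_iff less_le_trans pos2 of_nat_0_less_iff)
  moreover have "\<mu> = frame_multiplier n k"
  proof -
    have "t = real k / real n" using kt n by simp
    with frame_const_relations[OF \<open>1 \<le> k\<close> kn] have
      r: "frame_const n k > 0" "t * (1 - t) = (frame_const n k)\<^sup>2 * (real n - 1)"
        "1 - 2 * t = frame_const n k * frame_multiplier n k" by simp_all
    have "c\<^sup>2 = (frame_const n k)\<^sup>2" using r(2) tm n by simp
    then have "c = frame_const n k" using c r(1) by (simp add: power2_eq_iff_nonneg)
    then show ?thesis using r t_mu by simp
  qed
  ultimately show thesis by (rule that)
qed

text \<open>With \<open>s = (n - 1) / (k (n - k))\<close> the radicand \<open>4 (n - 1) + \<mu>\<^sup>2\<close> is \<open>n\<^sup>2 s\<close>, because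
  \<open>4 k (n - k) + (n - 2k)\<^sup>2 = n\<^sup>2\<close>; its root cancels the factor \<open>sqrt s\<close> of \<open>\<mu>\<close>.\<close>

lemma rank_from_multiplier:
  assumes "1 \<le> k" "k < n"
  shows "real k = real n / 2 -
    frame_multiplier n k * real n / (2 * sqrt (4 * (real n - 1) + (frame_multiplier n k)\<^sup>2))"
proof -
  define s where "s = (real n - 1) / (real k * (real n - real k))"
  have pos: "real k > 0" "real n - real k > 0" "real n - 1 > 0" "real n > 0" using assms by auto
  then have s: "s > 0" by (simp add: s_def)
  have mu: "frame_multiplier n k = (real n - 2 * real k) * sqrt s" by (simp add: frame_multiplier_def s_def)
  have "real n - 1 = real k * (real n - real k) * s" using pos by (simp add: s_def)
  then have "4 * (real n - 1) + (frame_multiplier n k)\<^sup>2 = (real n * sqrt s)\<^sup>2"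
    using s by (simp add: mu power_mult_distrib) (simp add: algebra_simps power2_eq_square)
  then have "sqrt (4 * (real n - 1) + (frame_multiplier n k)\<^sup>2) = real n * sqrt s"
    using s by simp
  then show ?thesis using pos s by (simp add: mu field_simps)
qed

section \<open>Convolution on the group\<close>

definition root_weight :: "'a set \<Rightarrow> 'a set \<Rightarrow> 'a set \<Rightarrow> 'a \<Rightarrow> complex" where
  "root_weight S T V x = of_bool (x \<in> S) + \<omega>\<^sub>3 * of_bool (x \<in> T) + \<omega>\<^sub>3\<^sup>2 * of_bool (x \<in> V)"

lemma (in group) N_mult_eq_convolution:
  assumes fin: "finite (carrier G)" and A: "A \<subseteq> carrier G" and B: "B \<subseteq> carrier G"
    and x: "x \<in> carrier G"
  shows "complex_of_nat (N_mult G A B x) =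
    (\<Sum>g\<in>carrier G. of_bool (g \<in> A) * of_bool (inv g \<otimes> x \<in> B))"
proof -
  have "{(g1, g2) \<in> A \<times> B. g1 \<otimes> g2 = x} = (\<lambda>g. (g, inv g \<otimes> x)) ` {g \<in> A. inv g \<otimes> x \<in> B}"
    (is "?L = ?R")
  proof (intro equalityI subsetI)
    fix z assume "z \<in> ?L"
    then obtain g h where z: "z = (g, h)" "g \<in> A" "h \<in> B" "g \<otimes> h = x" by auto
    then have "h = inv g \<otimes> x" using A B by (metis inv_solve_left subsetD x)
    with z show "z \<in> ?R" by auto
  next
    fix z assume "z \<in> ?R"
    then obtain g where "z = (g, inv g \<otimes> x)" "g \<in> A" "inv g \<otimes> x \<in> B" by auto
    then show "z \<in> ?L" using A x by (auto simp flip: m_assoc simp: subset_iff)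
  qed
  moreover have "inj_on (\<lambda>g. (g, inv g \<otimes> x)) {g \<in> A. inv g \<otimes> x \<in> B}" by (auto intro: inj_onI)
  ultimately have "N_mult G A B x = card {g \<in> A. inv g \<otimes> x \<in> B}"
    unfolding N_mult_def by (simp add: card_image)
  also have "{g \<in> A. inv g \<otimes> x \<in> B} = carrier G \<inter> {g. g \<in> A \<and> inv g \<otimes> x \<in> B}"
    using A by auto
  finally show ?thesis using fin by (simp flip: of_bool_conj)
qed

text \<open>The nine coefficients in \<open>F\<close> are the products of the values \<open>1\<close>, \<open>\<omega>\<close>, \<open>\<omega>\<^sup>2\<close> of the weight on
  \<open>S\<close>, \<open>T\<close>, \<open>V\<close>, so \<open>F\<close> is the convolution square of the weight.\<close>

lemma (in group) F_sum_eq_convolution: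
  assumes fin: "finite (carrier G)"
    and S: "S \<subseteq> carrier G" and T: "T \<subseteq> carrier G" and V: "V \<subseteq> carrier G" and x: "x \<in> carrier G"
  shows "F_sum G S T V x = (\<Sum>g\<in>carrier G. root_weight S T V g * root_weight S T V (inv g \<otimes> x))"
proof -
  note N = N_mult_eq_convolution[OF fin _ _ x]
  have expand: "(s + \<omega>\<^sub>3 * t + \<omega>\<^sub>3\<^sup>2 * v) * (s' + \<omega>\<^sub>3 * t' + \<omega>\<^sub>3\<^sup>2 * v') =
      s * s' + \<omega>\<^sub>3\<^sup>2 * (t * t') + \<omega>\<^sub>3 * (v * v') + \<omega>\<^sub>3 * (s * t' + t * s')
      + \<omega>\<^sub>3\<^sup>2 * (s * v' + v * s') + t * v' + v * t'" for s t v s' t' v'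
  proof -
    have "(s + \<omega>\<^sub>3 * t + \<omega>\<^sub>3\<^sup>2 * v) * (s' + \<omega>\<^sub>3 * t' + \<omega>\<^sub>3\<^sup>2 * v') =
      s * s' + \<omega>\<^sub>3\<^sup>2 * (t * t') + (\<omega>\<^sub>3\<^sup>2 * \<omega>\<^sub>3\<^sup>2) * (v * v') + \<omega>\<^sub>3 * (s * t' + t * s')
      + \<omega>\<^sub>3\<^sup>2 * (s * v' + v * s') + (\<omega>\<^sub>3 * \<omega>\<^sub>3\<^sup>2) * (t * v') + (\<omega>\<^sub>3 * \<omega>\<^sub>3\<^sup>2) * (v * t')"
      by (simp add: algebra_simps power2_eq_square)
    then show ?thesis by (simp only: omega3_cube omega3_fourth mult_1_left)
  qed
  show ?thesis
    unfolding root_weight_def expand F_sum_def N[OF S S] N[OF T T] N[OF V V] N[OF S T] N[OF T S]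
      N[OF S V] N[OF V S] N[OF T V] N[OF V T]
    by (simp only: sum.distrib sum_distrib_left distrib_left)
qed

text \<open>This is where integrality of \<open>\<mu>\<close> comes from: the only real Eisenstein integers are the
  ordinary ones.\<close>

lemma F_sum_Eisenstein:
  obtains a b :: int where "F_sum G S T V x = of_int a + of_int b * \<omega>\<^sub>3"
proof
  let ?N = "\<lambda>A B. int (N_mult G A B x)"
  show "F_sum G S T V x =
      of_int (?N S S - ?N T T - ?N S V - ?N V S + ?N T V + ?N V T) +
      of_int (?N V V + ?N S T + ?N T S - ?N T T - ?N S V - ?N V S) * \<omega>\<^sub>3"
    unfolding F_sum_def omega3_sq by (simp add: algebra_simps)
qed

text \<open>Exactly one \<open>g\<close> moves \<open>enum j\<close> to \<open>enum i\<close>, namely \<open>enum i \<otimes> inv enum j\<close>, so at most one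
  summand contributes to an entry.\<close>

lemma left_regular_sum_index:
  fixes G (structure)
  assumes grp: "group G" and fin: "finite (carrier G)"
    and enum: "bij_betw enum {..<Coset.order G} (carrier G)" and A: "A \<subseteq> carrier G"
  shows "left_regular_sum G enum A \<in> carrier_mat (Coset.order G) (Coset.order G)"
    and "i < Coset.order G \<Longrightarrow> j < Coset.order G \<Longrightarrow>
      left_regular_sum G enum A $$ (i, j) = of_bool (enum i \<otimes> inv enum j \<in> A)"
proof -
  interpret group G by (rule grp)
  let ?n = "Coset.order G"
  let ?M = "module_mat TYPE(complex) ?n ?n"
  interpret M: abelian_group ?M by (rule abelian_group_mat)
  have reg: "left_regular G enum g \<in> carrier ?M" for g
    by (simp add: left_regular_def module_mat_simps)
  have "finite A" using A fin finite_subset by blast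
  then have "left_regular_sum G enum A \<in> carrier_mat ?n ?n \<and> (\<forall>i<?n. \<forall>j<?n.
      left_regular_sum G enum A $$ (i, j) = of_bool (enum i \<otimes> inv enum j \<in> A))"
    using A
  proof (induction A)
    case empty
    then show ?case by (simp add: left_regular_sum_def module_mat_simps)
  next
    case (insert g A)
    have step: "left_regular_sum G enum (insert g A) = left_regular G enum g + left_regular_sum G enum A"
      unfolding left_regular_sum_def using insert.hyps reg
      by (subst M.finsum_insert) (auto simp: module_mat_simps)
    have IH: "left_regular_sum G enum A \<in> carrier_mat ?n ?n"
      "\<And>i j. i < ?n \<Longrightarrow> j < ?n \<Longrightarrow>
        left_regular_sum G enum A $$ (i, j) = of_bool (enum i \<otimes> inv enum j \<in> A)"
      using insert by auto
    have mem: "enum i \<in> carrier G" if "i < ?n" for i using enum that by (auto simp: bij_betw_def)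
    have "enum i = g \<otimes> enum j \<longleftrightarrow> enum i \<otimes> inv enum j = g" if "i < ?n" "j < ?n" for i j
      using inv_solve_right[of g "enum i" "enum j"] mem that insert.prems by auto
    then show ?case
      unfolding step using IH insert.hyps by (auto simp: left_regular_def)
  qed
  then show "left_regular_sum G enum A \<in> carrier_mat ?n ?n"
    and "i < ?n \<Longrightarrow> j < ?n \<Longrightarrow>
      left_regular_sum G enum A $$ (i, j) = of_bool (enum i \<otimes> inv enum j \<in> A)"
    by auto
qed

section \<open>Signature pairs as solutions of a convolution equation\<close>

locale group_partition = group G for G (structure) +
  fixes n :: nat and enum :: "nat \<Rightarrow> 'a" and S T V :: "'a set"
  assumes order: "Coset.order G = n" and n2: "n \<ge> 2"
    and enum: "bij_betw enum {..<n} (carrier G)"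
    and S: "S \<subseteq> carrier G - {\<one>}" and T: "T \<subseteq> carrier G - {\<one>}" and ST: "S \<inter> T = {}"
    and V: "V = (carrier G - {\<one>}) - (S \<union> T)"
begin

abbreviation q :: "'a \<Rightarrow> complex" where "q \<equiv> root_weight S T V"

lemma finite_carrier: "finite (carrier G)"
  using enum bij_betw_finite by blast

lemma subsets: "S \<subseteq> carrier G" "T \<subseteq> carrier G" "V \<subseteq> carrier G"
  using S T V by auto

lemma enum_closed: "i < n \<Longrightarrow> enum i \<in> carrier G"
  using enum by (auto simp: bij_betw_def)

lemma enum_surj: "x \<in> carrier G \<Longrightarrow> \<exists>i<n. x = enum i"
  using enum by (auto simp: bij_betw_def)

lemma weight_cases:
  assumes "x \<in> carrier G"
  obtains "x = \<one>" "q x = 0" | "x \<in> S" "q x = 1" | "x \<in> T" "q x = \<omega>\<^sub>3" | "x \<in> V" "q x = \<omega>\<^sub>3\<^sup>2"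
proof -
  consider "x = \<one>" | "x \<in> S" | "x \<in> T" | "x \<in> V" using assms V by auto
  then show thesis
  proof cases
    case 1
    then have "q x = 0" using S T V by (auto simp: root_weight_def)
    with 1 show thesis by (rule that(1))
  next
    case 2
    then have "q x = 1" using ST V by (auto simp: root_weight_def)
    with 2 show thesis by (rule that(2))
  next
    case 3
    then have "q x = \<omega>\<^sub>3" using ST V by (auto simp: root_weight_def)
    with 3 show thesis by (rule that(3))
  next
    case 4
    then have "q x = \<omega>\<^sub>3\<^sup>2" using V by (auto simp: root_weight_def)
    with 4 show thesis by (rule that(4))
  qed
qed

lemma weight_one: "q \<one> = 0" using S T V by (auto simp: root_weight_def)

lemma weight_unimodular:
  assumes "x \<in> carrier G" "x \<noteq> \<one>" shows "cmod (q x) = 1"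
  using assms(1) by (cases rule: weight_cases) (use assms(2) cmod_omega3 in \<open>auto simp: norm_power\<close>)

text \<open>Complex conjugation fixes \<open>1\<close> and exchanges \<open>\<omega>\<close> and \<open>\<omega>\<^sup>2\<close>, and these three values tell \<open>S\<close>,
  \<open>T\<close> and \<open>V\<close> apart. This is the self-adjointness of the signature matrix, read on the group.\<close>

lemma weight_inv_iff:
  "(\<forall>x\<in>carrier G. q (inv x) = cnj (q x)) \<longleftrightarrow> S = set_inv S \<and> set_inv T = V"
proof -
  have levels: "x \<in> S \<longleftrightarrow> q x = 1" "x \<in> T \<longleftrightarrow> q x = \<omega>\<^sub>3" "x \<in> V \<longleftrightarrow> q x = \<omega>\<^sub>3\<^sup>2"
    if "x \<in> carrier G" for x
    using that omega3_distinct S T ST V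
    by (cases rule: weight_cases; force)+
  have set_inv: "x \<in> set_inv A \<longleftrightarrow> inv x \<in> A" if "A \<subseteq> carrier G" "x \<in> carrier G" for A x
    using that by (force simp: SET_INV_def)
  have inv_sub: "set_inv A \<subseteq> carrier G" if "A \<subseteq> carrier G" for A
    using that by (auto simp: SET_INV_def)
  show ?thesis
  proof
    assume q: "\<forall>x\<in>carrier G. q (inv x) = cnj (q x)"
    have mem: "x \<in> S \<longleftrightarrow> x \<in> set_inv S" "x \<in> set_inv T \<longleftrightarrow> x \<in> V" if x: "x \<in> carrier G" for x
    proof -
      have ix: "inv x \<in> carrier G" and qi: "q (inv x) = cnj (q x)" using q x by auto
      have "x \<in> set_inv S \<longleftrightarrow> cnj (q x) = cnj 1"
        unfolding set_inv[OF subsets(1) x] levels(1)[OF ix] qi by simp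
      then show "x \<in> S \<longleftrightarrow> x \<in> set_inv S"
        unfolding complex_cnj_cancel_iff levels(1)[OF x] by simp
      have "x \<in> set_inv T \<longleftrightarrow> cnj (q x) = cnj (\<omega>\<^sub>3\<^sup>2)"
        unfolding set_inv[OF subsets(2) x] levels(2)[OF ix] qi cnj_omega3_sq by simp
      then show "x \<in> set_inv T \<longleftrightarrow> x \<in> V"
        unfolding complex_cnj_cancel_iff levels(3)[OF x] by simp
    qed
    show "S = set_inv S \<and> set_inv T = V"
    proof
      have eqI: "A = B" if "A \<subseteq> carrier G" "B \<subseteq> carrier G"
        and "\<And>x. x \<in> carrier G \<Longrightarrow> x \<in> A \<longleftrightarrow> x \<in> B" for A B
        using that by blast
      show "S = set_inv S" using subsets(1) inv_sub[OF subsets(1)] mem(1) by (rule eqI)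
      show "set_inv T = V" using inv_sub[OF subsets(2)] subsets(3) mem(2) by (rule eqI)
    qed
  next
    assume "S = set_inv S \<and> set_inv T = V"
    then have inv: "set_inv S = S" "set_inv T = V" by blast+
    show "\<forall>x\<in>carrier G. q (inv x) = cnj (q x)"
    proof
      fix x assume x: "x \<in> carrier G"
      then have ix: "inv x \<in> carrier G" "inv (inv x) = x" by auto
      from x show "q (inv x) = cnj (q x)"
      proof (cases rule: weight_cases)
        case 1 then show ?thesis by (simp add: weight_one)
      next
        case 2
        then have "inv x \<in> S" using inv(1) set_inv[OF subsets(1) x] by simp
        then show ?thesis using 2 levels ix by simp
      next
        case 3
        then have "inv x \<in> V" using inv(2) ix set_inv[OF subsets(2) ix(1)] by simp
        then show ?thesis using 3 levels ix cnj_omega3 by simp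
      next
        case 4
        then have "inv x \<in> T" using inv(2) set_inv[OF subsets(2) x] by simp
        then show ?thesis using 4 levels ix cnj_omega3_sq by simp
      qed
    qed
  qed
qed

text \<open>Away from the identity this only rephrases the three conditions. At the identity the convolution
  square is \<open>\<Sum>\<^sub>g q g * q (inv g) = \<Sum>\<^sub>g |q g|\<^sup>2 = n - 1\<close>, so the equation holds there
  automatically.\<close>

lemma F_condition_iff_convolution:
  assumes herm: "\<forall>x\<in>carrier G. q (inv x) = cnj (q x)"
  shows "F_condition G S T V \<mu> \<longleftrightarrow>
    (\<forall>x\<in>carrier G. F_sum G S T V x = of_real (real n - 1) * of_bool (x = \<one>) + of_int \<mu> * q x)"
    (is "_ \<longleftrightarrow> (\<forall>x\<in>carrier G. ?E x)")
proof -
  have "F_sum G S T V \<one> = (\<Sum>g\<in>carrier G. of_bool (g \<noteq> \<one>))"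
    unfolding F_sum_eq_convolution[OF finite_carrier subsets one_closed]
  proof (intro sum.cong refl)
    fix g assume g: "g \<in> carrier G"
    then have "q g * q (inv g \<otimes> \<one>) = of_real ((cmod (q g))\<^sup>2)"
      using herm by (simp add: complex_norm_square del: of_real_power)
    then show "q g * q (inv g \<otimes> \<one>) = of_bool (g \<noteq> \<one>)"
      using g weight_unimodular weight_one by (cases "g = \<one>") auto
  qed
  also have "\<dots> = of_nat (card (carrier G - {\<one>}))"
  proof -
    have "carrier G \<inter> {g. g \<noteq> \<one>} = carrier G - {\<one>}" by auto
    then show ?thesis using finite_carrier by simp
  qed
  also have "card (carrier G - {\<one>}) = n - 1"
    using finite_carrier order by (simp add: Coset.order_def)
  finally have one: "?E \<one>" using n2 weight_one by (simp add: of_nat_diff)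
  have E: "?E x \<longleftrightarrow> F_sum G S T V x = q x * of_int \<mu>" if "x \<noteq> \<one>" for x
    using that by (simp add: mult.commute)
  have split: "(\<forall>x\<in>carrier G. ?E x) \<longleftrightarrow> (\<forall>x\<in>S. ?E x) \<and> (\<forall>x\<in>T. ?E x) \<and> (\<forall>x\<in>V. ?E x)"
    using one S T V by blast
  have lev: "x \<in> S \<Longrightarrow> x \<noteq> \<one> \<and> q x = 1" "x \<in> T \<Longrightarrow> x \<noteq> \<one> \<and> q x = \<omega>\<^sub>3" "x \<in> V \<Longrightarrow> x \<noteq> \<one> \<and> q x = \<omega>\<^sub>3\<^sup>2" for x
    using S T ST V by (auto simp: root_weight_def)
  show ?thesis unfolding split F_condition_def
    using lev E by (auto cong: ball_cong)
qed

text \<open>The operator \<open>\<Sum>\<^sub>g q g \<lambda>(g)\<close> has entry \<open>q (enum i \<otimes> inv enum j)\<close> at \<open>(i, j)\<close>. Every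
  element of the group is such a quotient (\<open>all_quotients_iff\<close>), so entrywise statements about
  these matrices are statements about functions on the group.\<close>

lemma quotient_closed: "i < n \<Longrightarrow> j < n \<Longrightarrow> enum i \<otimes> inv enum j \<in> carrier G"
  using enum_closed by simp

lemma quotient_eq_one_iff:
  assumes "i < n" "j < n"
  shows "enum i \<otimes> inv enum j = \<one> \<longleftrightarrow> i = j"
proof -
  have "enum i \<otimes> inv enum j = \<one> \<longleftrightarrow> enum i = enum j"
    using assms enum_closed inv_solve_right'[of \<one> "enum i" "enum j"] by auto
  then show ?thesis using enum assms by (auto simp: bij_betw_def inj_on_def)
qed

lemma all_quotients_iff:
  "(\<forall>i<n. \<forall>j<n. P (enum i \<otimes> inv enum j)) \<longleftrightarrow> (\<forall>x\<in>carrier G. P x)"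
proof
  assume P: "\<forall>i<n. \<forall>j<n. P (enum i \<otimes> inv enum j)"
  show "\<forall>x\<in>carrier G. P x"
  proof
    fix x assume x: "x \<in> carrier G"
    obtain i j where "i < n" "x = enum i" "j < n" "\<one> = enum j" using enum_surj x by blast
    then show "P x" using P x by (metis inv_one r_one)
  qed
qed (use quotient_closed in blast)

text \<open>Multiplicativity of the left regular representation: the square of the operator of \<open>q\<close> is the
  operator of the convolution square.\<close>

lemma weight_matrix_square:
  assumes ij: "i < n" "j < n"
  shows "(\<Sum>l<n. q (enum i \<otimes> inv enum l) * q (enum l \<otimes> inv enum j)) =
    F_sum G S T V (enum i \<otimes> inv enum j)"
proof -
  have bij: "bij_betw (\<lambda>l. enum i \<otimes> inv enum l) {..<n} (carrier G)"
  proof -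
    have "bij_betw (\<lambda>h. enum i \<otimes> inv h) (carrier G) (carrier G)"
      by (rule bij_betw_byWitness[where f' = "\<lambda>g. inv g \<otimes> enum i"])
        (use enum_closed[OF ij(1)] in \<open>auto simp: inv_mult_group m_assoc simp flip: m_assoc[of _ "inv (enum i)"] \<close>)
    from bij_betw_trans[OF enum this] show ?thesis by (simp add: o_def)
  qed
  have "F_sum G S T V (enum i \<otimes> inv enum j) =
      (\<Sum>l<n. q (enum i \<otimes> inv enum l) * q (inv (enum i \<otimes> inv enum l) \<otimes> (enum i \<otimes> inv enum j)))"
    unfolding F_sum_eq_convolution[OF finite_carrier subsets quotient_closed[OF ij]]
    by (rule sum.reindex_bij_betw[OF bij, symmetric])
  also have "\<dots> = (\<Sum>l<n. q (enum i \<otimes> inv enum l) * q (enum l \<otimes> inv enum j))"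
  proof (intro sum.cong refl)
    fix l assume "l \<in> {..<n}"
    then have l: "l < n" by simp
    have "inv a \<otimes> (a \<otimes> z) = z" if "a \<in> carrier G" "z \<in> carrier G" for a z
      using that by (simp flip: m_assoc)
    then have "inv (enum i \<otimes> inv enum l) \<otimes> (enum i \<otimes> inv enum j) = enum l \<otimes> inv enum j"
      using enum_closed ij l by (simp add: inv_mult_group m_assoc)
    then show "q (enum i \<otimes> inv enum l) * q (inv (enum i \<otimes> inv enum l) \<otimes> (enum i \<otimes> inv enum j))
        = q (enum i \<otimes> inv enum l) * q (enum l \<otimes> inv enum j)" by simp
  qed
  finally show ?thesis by simp
qed

lemma weight_matrix_hermitian_iff:
  "(\<forall>i<n. \<forall>j<n. q (enum j \<otimes> inv enum i) = cnj (q (enum i \<otimes> inv enum j))) \<longleftrightarrow>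
    (\<forall>x\<in>carrier G. q (inv x) = cnj (q x))"
  unfolding all_quotients_iff[of "\<lambda>x. q (inv x) = cnj (q x)", symmetric]
  using enum_closed by (simp add: inv_mult_group)

lemma weight_matrix_quadratic_iff:
  "(\<forall>i<n. \<forall>j<n. (\<Sum>l<n. q (enum i \<otimes> inv enum l) * q (enum l \<otimes> inv enum j)) =
      c * of_bool (i = j) + m * q (enum i \<otimes> inv enum j)) \<longleftrightarrow>
    (\<forall>x\<in>carrier G. F_sum G S T V x = c * of_bool (x = \<one>) + m * q x)"
  unfolding all_quotients_iff[symmetric]
  by (intro all_cong1 imp_cong refl) (simp only: quotient_eq_one_iff weight_matrix_square)

lemma cube_root_signature_pair_iff:
  "cube_root_signature_pair G enum k S T \<longleftrightarrow> 1 \<le> k \<and> k < n \<and>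
    (\<forall>x\<in>carrier G. q (inv x) = cnj (q x)) \<and>
    (\<forall>x\<in>carrier G. F_sum G S T V x =
       of_real (real n - 1) * of_bool (x = \<one>) + of_real (frame_multiplier n k) * q x)"
proof -
  define Q where "Q = left_regular_sum G enum S + \<omega>\<^sub>3 \<cdot>\<^sub>m left_regular_sum G enum T
           + \<omega>\<^sub>3\<^sup>2 \<cdot>\<^sub>m left_regular_sum G enum V"
  have pair: "cube_root_signature_pair G enum k S T \<longleftrightarrow> signature_matrix n k Q"
    unfolding cube_root_signature_pair_def Q_def by (simp add: order flip: V)
  note idx = left_regular_sum_index[OF group_axioms finite_carrier, of enum, unfolded order, OF enum]
  have Q: "Q \<in> carrier_mat n n"
    unfolding Q_def using idx(1) subsets by simp
  have Q_entry: "Q $$ (i, j) = q (enum i \<otimes> inv enum j)" if "i < n" "j < n" for i j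
    unfolding Q_def using idx subsets that carrier_matD[OF idx(1)] by (simp add: root_weight_def)
  have Q_square: "(\<Sum>l<n. Q $$ (i, l) * Q $$ (l, j)) =
      (\<Sum>l<n. q (enum i \<otimes> inv enum l) * q (enum l \<otimes> inv enum j))" if "i < n" "j < n" for i j
    using that by (intro sum.cong refl) (simp add: Q_entry)
  have "Q $$ (i, i) = 0" if "i < n" for i
    using Q_entry[OF that that] quotient_eq_one_iff[OF that that] weight_one by simp
  moreover have "cmod (Q $$ (i, j)) = 1" if "i < n" "j < n" "i \<noteq> j" for i j
    using Q_entry quotient_closed quotient_eq_one_iff that weight_unimodular by simp
  ultimately have "signature_matrix n k Q \<longleftrightarrow> 1 \<le> k \<and> k < n \<and>
      (\<forall>i<n. \<forall>j<n. Q $$ (j, i) = cnj (Q $$ (i, j))) \<and>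
      (\<forall>i<n. \<forall>j<n. (\<Sum>l<n. Q $$ (i, l) * Q $$ (l, j)) =
        of_real (real n - 1) * of_bool (i = j) + of_real (frame_multiplier n k) * Q $$ (i, j))"
    by (rule signature_matrix_iff_quadratic[OF Q])
  also have "(\<forall>i<n. \<forall>j<n. Q $$ (j, i) = cnj (Q $$ (i, j))) \<longleftrightarrow>
      (\<forall>x\<in>carrier G. q (inv x) = cnj (q x))"
    unfolding weight_matrix_hermitian_iff[symmetric]
    by (intro all_cong1 imp_cong refl) (simp only: Q_entry)
  also have "(\<forall>i<n. \<forall>j<n. (\<Sum>l<n. Q $$ (i, l) * Q $$ (l, j)) =
        of_real (real n - 1) * of_bool (i = j) + of_real (frame_multiplier n k) * Q $$ (i, j)) \<longleftrightarrow>
      (\<forall>x\<in>carrier G. F_sum G S T V x =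
        of_real (real n - 1) * of_bool (x = \<one>) + of_real (frame_multiplier n k) * q x)"
    unfolding weight_matrix_quadratic_iff[symmetric]
    by (intro all_cong1 imp_cong refl) (simp only: Q_entry Q_square)
  finally show ?thesis unfolding pair .
qed

text \<open>A solution of the convolution equation with any real coefficient \<open>m\<close> is the
  signature condition for some \<open>k\<close>: the required \<open>k\<close> is the multiplicity of the positive
  eigenvalue.\<close>

lemma exists_rank_of_convolution:
  assumes herm: "\<forall>x\<in>carrier G. q (inv x) = cnj (q x)"
    and F: "\<forall>x\<in>carrier G. F_sum G S T V x =
      of_real (real n - 1) * of_bool (x = \<one>) + of_real m * q x"
  obtains k where "1 \<le> k" "k < n" "m = frame_multiplier n k"
proof (rule quadratic_hermitian_rank[OF n2, of "\<lambda>i j. q (enum i \<otimes> inv enum j)" m])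
  show "q (enum j \<otimes> inv enum i) = cnj (q (enum i \<otimes> inv enum j))" if "i < n" "j < n" for i j
    using iffD2[OF weight_matrix_hermitian_iff herm] that by blast
  show "q (enum i \<otimes> inv enum i) = 0" if "i < n" for i
    using quotient_eq_one_iff[OF that that] weight_one by simp
  show "(\<Sum>l<n. q (enum i \<otimes> inv enum l) * q (enum l \<otimes> inv enum j)) =
      of_real (real n - 1) * of_bool (i = j) + of_real m * q (enum i \<otimes> inv enum j)"
    if "i < n" "j < n" for i j
    using iffD2[OF weight_matrix_quadratic_iff F] that by blast
qed (rule that)

lemma exists_nontrivial: "\<exists>x\<in>carrier G. x \<noteq> \<one>"
proof (rule ccontr)
  assume "\<not> ?thesis"
  then have "card (carrier G) \<le> card {\<one>}" by (intro card_mono) auto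
  then show False using order n2 by (simp add: Coset.order_def)
qed

text \<open>At any \<open>x \<noteq> \<one>\<close>, the Eisenstein integer \<open>F x\<close> equals \<open>m\<close>, \<open>m \<omega>\<close> or \<open>m \<omega>\<^sup>2\<close>; comparing
  imaginary parts makes \<open>m\<close> an integer in each case. Since \<open>S\<close> may be empty, all three cases
  are needed.\<close>

lemma real_multiplier_integral:
  fixes m :: real
  assumes F: "\<And>x. x \<in> carrier G \<Longrightarrow> x \<noteq> \<one> \<Longrightarrow> F_sum G S T V x = of_real m * q x"
  obtains \<mu> :: int where "m = of_int \<mu>"
proof -
  obtain x where x: "x \<in> carrier G" "x \<noteq> \<one>" using exists_nontrivial by blast
  obtain a b :: int where ab: "F_sum G S T V x = of_int a + of_int b * \<omega>\<^sub>3"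
    by (rule F_sum_Eisenstein)
  have eq: "of_real m * q x = of_int a + of_int b * \<omega>\<^sub>3" using F[OF x] ab by simp
  have Im: "Im (of_real m * q x) = of_int b * (sqrt 3 / 2)"
    unfolding eq by (simp add: Im_omega3)
  from x(1) show thesis
  proof (cases rule: weight_cases)
    case 1 with x show thesis by simp
  next
    case 2
    then have "b = 0" using Im by simp
    then have "complex_of_real m = of_real (of_int a)" using eq 2 by simp
    then show thesis using that[of a] unfolding of_real_eq_iff by simp
  next
    case 3
    then have "m = of_int b" using Im by (simp add: Im_omega3)
    then show thesis by (rule that)
  next
    case 4
    have "Im (\<omega>\<^sub>3\<^sup>2) = - (sqrt 3 / 2)" by (simp add: omega3_sq Im_omega3)
    then have "(m + of_int b) * (sqrt 3 / 2) = 0" using Im 4 by (simp add: algebra_simps)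
    then have "m = of_int (- b)" by simp
    then show thesis by (rule that)
  qed
qed

lemma multiplier_unique:
  assumes "\<forall>x\<in>carrier G. F_sum G S T V x = c * of_bool (x = \<one>) + of_real m * q x"
    and "\<forall>x\<in>carrier G. F_sum G S T V x = c * of_bool (x = \<one>) + of_int \<mu> * q x"
  shows "of_int \<mu> = m"
proof -
  obtain x where x: "x \<in> carrier G" "x \<noteq> \<one>" using exists_nontrivial by blast
  then have "of_int \<mu> * q x = of_real m * q x"
    using assms[rule_format, OF x(1)] by simp
  moreover have "q x \<noteq> 0" using weight_unimodular[OF x] by auto
  ultimately have "complex_of_real (of_int \<mu>) = of_real m" by simp
  then show ?thesis unfolding of_real_eq_iff by simp
qed

end

section \<open>Cube root signature pairs\<close>

theorem theorem6p2:
  fixes G :: "('a, 'b) monoid_scheme" and n :: nat and enum :: "nat \<Rightarrow> 'a"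
    and S T V :: "'a set"
  assumes "group G" and "Coset.order G = n" and "n \<ge> 2"
    and "bij_betw enum {..<n} (carrier G)"
    and "S \<subseteq> carrier G - {\<one>\<^bsub>G\<^esub>}" and "T \<subseteq> carrier G - {\<one>\<^bsub>G\<^esub>}" and "S \<inter> T = {}"
    and "V = (carrier G - {\<one>\<^bsub>G\<^esub>}) - (S \<union> T)"
  shows "((\<exists>k. cube_root_signature_pair G enum k S T) \<longleftrightarrow>
            (S = set_inv\<^bsub>G\<^esub> S \<and> set_inv\<^bsub>G\<^esub> T = V) \<and> (\<exists>\<mu>::int. F_condition G S T V \<mu>))
       \<and> (\<forall>k (\<mu>::int). cube_root_signature_pair G enum k S T \<and> F_condition G S T V \<mu> \<longrightarrow>
            real_of_int \<mu> = (real n - 2 * real k) * sqrt ((real n - 1) / (real k * (real n - real k))) \<and>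
            real k = real n / 2 - real_of_int \<mu> * real n / (2 * sqrt (4 * (real n - 1) + (real_of_int \<mu>)\<^sup>2)))"
proof -
  interpret group_partition G n enum S T V
    using assms by (intro group_partition.intro group_partition_axioms.intro)
  let ?H = "\<forall>x\<in>carrier G. q (inv\<^bsub>G\<^esub> x) = cnj (q x)"
  let ?E = "\<lambda>m :: real. \<forall>x\<in>carrier G. F_sum G S T V x =
    of_real (real n - 1) * of_bool (x = \<one>\<^bsub>G\<^esub>) + of_real m * q x"
  have F: "F_condition G S T V \<mu> \<longleftrightarrow> ?E (of_int \<mu>)" if ?H for \<mu>
    using F_condition_iff_convolution[OF that, of \<mu>] by simp
  have existence: "(\<exists>k. cube_root_signature_pair G enum k S T) \<longleftrightarrow> ?H \<and> (\<exists>\<mu>. F_condition G S T V \<mu>)"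
  proof
    assume "\<exists>k. cube_root_signature_pair G enum k S T"
    then obtain k where H: ?H and E: "?E (frame_multiplier n k)"
      unfolding cube_root_signature_pair_iff by (elim exE conjE)
    obtain \<mu> :: int where "frame_multiplier n k = of_int \<mu>"
      by (rule real_multiplier_integral[of "frame_multiplier n k"]) (use E in simp)
    then have "F_condition G S T V \<mu>" using E unfolding F[OF H] by simp
    with H show "?H \<and> (\<exists>\<mu>. F_condition G S T V \<mu>)" by (intro conjI exI)
  next
    assume "?H \<and> (\<exists>\<mu>. F_condition G S T V \<mu>)"
    then obtain \<mu> where H: ?H and "F_condition G S T V \<mu>" by (elim conjE exE)
    then have E: "?E (of_int \<mu>)" unfolding F[OF H] by simp
    obtain k where k: "1 \<le> k" "k < n" "of_int \<mu> = frame_multiplier n k"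
      using H E by (rule exists_rank_of_convolution)
    from E have "?E (frame_multiplier n k)" unfolding k(3) .
    with k(1,2) H have "cube_root_signature_pair G enum k S T"
      unfolding cube_root_signature_pair_iff by (intro conjI)
    then show "\<exists>k. cube_root_signature_pair G enum k S T" by (rule exI)
  qed
  have formulas: "real_of_int \<mu> = (real n - 2 * real k) * sqrt ((real n - 1) / (real k * (real n - real k))) \<and>
      real k = real n / 2 - real_of_int \<mu> * real n / (2 * sqrt (4 * (real n - 1) + (real_of_int \<mu>)\<^sup>2))"
    if pair: "cube_root_signature_pair G enum k S T" and cond: "F_condition G S T V \<mu>" for k \<mu>
  proof -
    from pair have k: "1 \<le> k" "k < n" and H: ?H and E: "?E (frame_multiplier n k)"
      unfolding cube_root_signature_pair_iff by blast+
    have mu: "of_int \<mu> = frame_multiplier n k"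
      using E cond[unfolded F_condition_iff_convolution[OF H]] by (rule multiplier_unique)
    show ?thesis
    proof
      show "real_of_int \<mu> = (real n - 2 * real k) * sqrt ((real n - 1) / (real k * (real n - real k)))"
        unfolding mu frame_multiplier_def ..
      show "real k = real n / 2 -
          real_of_int \<mu> * real n / (2 * sqrt (4 * (real n - 1) + (real_of_int \<mu>)\<^sup>2))"
        unfolding mu by (rule rank_from_multiplier[OF k])
    qed
  qed
  show ?thesis
    by (rule conjI[OF existence[unfolded weight_inv_iff]]) (intro allI impI, elim conjE, rule formulas)
qed

end
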